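(* Let $L=\langle R_i : i\in I\rangle$ be a relational language and let $\mathbb X$ be an $L$-structure with domain $X$ of infinite cardinality $\kappa\geq\omega$. Then the following conditions (a) and (b) are equivalent, and if $\kappa=\omega$ they are also equivalent to (c): (a) $\mathbb X$ is not a reversible structure; (b) there are a bad partial condensation $\varphi^*\in \mathrm{Bad}(\mathbb X)$ and a $\kappa$-closed back and forth system of condensations $\Pi\subset \mathrm{Pc}_{\varphi^*}(\mathbb X)$; (c) there exists a back and forth system of condensations $\Pi\subset \mathrm{Pc}(\mathbb X)$ containing a bad condensation.
   Context: $L=\langle R_i:i\in I\rangle$ is a relational language with $\mathrm{ar}(R_i)=n_i\in\mathbb N=\{1,2,\dots\}$. The symbol $\subset$ denotes (not necessarily proper) inclusion. An $L$-structure $\mathbb X$ with domain $X$ is reversible iff each bijective homomorphism $f:\mathbb X\to\mathbb X$ (a condensation) is an automorphism of $\mathbb X$. A function $\varphi$ is a partial condensation of $\mathbb X$, written $\varphi\in\mathrm{Pc}(\mathbb X)$, iff $\varphi$ is a bijection from $\mathrm{dom}(\varphi)\subset X$ onto $\mathrm{ran}(\varphi)\subset X$ and for all $i\in I$ and all $\bar x\in(\mathrm{dom}\,\varphi)^{n_i}$: $\bar x\in R_i^{\mathbb X}\Rightarrow \varphi\bar x\in R_i^{\mathbb X}$, where $\varphi\bar x$ is the tuple obtained by applying $\varphi$ coordinatewise. A partial condensation $\varphi^*$ is bad, written $\varphi^*\in\mathrm{Bad}(\mathbb X)$, iff it is not a partial isomorphism, that is, there are $i\in I$ and $\bar x\in(\mathrm{dom}\,\varphi^*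 )^{n_i}$ with $\bar x\notin R_i^{\mathbb X}$ and $\varphi^*\bar x\in R_i^{\mathbb X}$. Let $\mathrm{Pc}_{\varphi^*}(\mathbb X)=\{\varphi\in\mathrm{Pc}(\mathbb X):\varphi^*\subset\varphi\}$. A set $\Pi\subset\mathrm{Pc}(\mathbb X)$ is a back and forth system of condensations (b.f.s.) iff $\Pi\neq\emptyset$ and (bf1) $\forall\varphi\in\Pi\ \forall a\in X\ \exists\psi\in\Pi\ (\varphi\subset\psi\wedge a\in\mathrm{dom}\,\psi)$; (bf2) $\forall\varphi\in\Pi\ \forall b\in X\ \exists\psi\in\Pi\ (\varphi\subset\psi\wedge b\in\mathrm{ran}\,\psi)$. A partial order $\langle P,\leq\rangle$ is $\kappa$-closed iff whenever $\gamma<\kappa$ is an ordinal and $\langle p_\alpha:\alpha<\gamma\rangle$ is a sequence in $P$ with $p_\beta\leq p_\alpha$ for $\alpha<\beta<\gamma$, there is $p\in P$ with $p\leq p_\alpha$ for all $\alpha<\gamma$. A b.f.s. $\Pi$ is $\kappa$-closed iff the partial order $\langle\Pi,\supset\rangle$ (i.e. $\psi\leq\varphi$ iff $\psi\supset\varphi$) is $\kappa$-closed. *)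

theory Defs
  imports Main
begin

unbundle cardinal_syntax

record 'i rel_lang =
  idx :: "'i set"
  ar :: "'i \<Rightarrow> nat"

record ('i, 'a) rel_struct =
  univ :: "'a set"
  rel :: "'i \<Rightarrow> 'a list set"

definition relational_language :: "'i rel_lang \<Rightarrow> bool" where
  "relational_language L \<longleftrightarrow> (\<forall>i\<in>idx L. 1 \<le> ar L i)"

definition tuples :: "'a set \<Rightarrow> nat \<Rightarrow> 'a list set" where
  "tuples A n = {xs. set xs \<subseteq> A \<and> length xs = n}"

definition structure_for :: "'i rel_lang \<Rightarrow> ('i, 'a) rel_struct \<Rightarrow> bool" where
  "structure_for L X \<longleftrightarrow> (\<forall>i\<in>idx L. rel X i \<subseteq> tuples (univ X) (ar L i))"

definition condensation :: "'i rel_lang \<Rightarrow> ('i, 'a) rel_struct \<Rightarrow> ('a \<Rightarrow> 'a) \<Rightarrow> bool" where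
  "condensation L X f \<longleftrightarrow> bij_betw f (univ X) (univ X) \<and>
     (\<forall>i\<in>idx L. \<forall>xs\<in>tuples (univ X) (ar L i). xs \<in> rel X i \<longrightarrow> map f xs \<in> rel X i)"

definition automorphism :: "'i rel_lang \<Rightarrow> ('i, 'a) rel_struct \<Rightarrow> ('a \<Rightarrow> 'a) \<Rightarrow> bool" where
  "automorphism L X f \<longleftrightarrow> bij_betw f (univ X) (univ X) \<and>
     (\<forall>i\<in>idx L. \<forall>xs\<in>tuples (univ X) (ar L i). xs \<in> rel X i \<longleftrightarrow> map f xs \<in> rel X i)"

definition reversible :: "'i rel_lang \<Rightarrow> ('i, 'a) rel_struct \<Rightarrow> bool" where
  "reversible L X \<longleftrightarrow> (\<forall>f. condensation L X f \<longrightarrow> automorphism L X f)"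

text \<open>Partial functions are maps, and inclusion of partial functions is \<open>\<subseteq>\<^sub>m\<close>. The coordinatewise
  action is only ever used on tuples over the domain of the map.\<close>

definition app_tuple :: "('a \<rightharpoonup> 'a) \<Rightarrow> 'a list \<Rightarrow> 'a list" where
  "app_tuple \<phi> xs = map (\<lambda>x. the (\<phi> x)) xs"

definition Pc :: "'i rel_lang \<Rightarrow> ('i, 'a) rel_struct \<Rightarrow> ('a \<rightharpoonup> 'a) set" where
  "Pc L X = {\<phi>. dom \<phi> \<subseteq> univ X \<and> ran \<phi> \<subseteq> univ X \<and> inj_on \<phi> (dom \<phi>) \<and>
     (\<forall>i\<in>idx L. \<forall>xs\<in>tuples (dom \<phi>) (ar L i). xs \<in> rel X i \<longrightarrow> app_tuple \<phi> xs \<in> rel X i)}"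

definition Bad :: "'i rel_lang \<Rightarrow> ('i, 'a) rel_struct \<Rightarrow> ('a \<rightharpoonup> 'a) set" where
  "Bad L X = {\<phi> \<in> Pc L X.
     \<exists>i\<in>idx L. \<exists>xs\<in>tuples (dom \<phi>) (ar L i). xs \<notin> rel X i \<and> app_tuple \<phi> xs \<in> rel X i}"

definition Pc_above :: "'i rel_lang \<Rightarrow> ('i, 'a) rel_struct \<Rightarrow> ('a \<rightharpoonup> 'a) \<Rightarrow> ('a \<rightharpoonup> 'a) set" where
  "Pc_above L X \<phi>s = {\<phi> \<in> Pc L X. \<phi>s \<subseteq>\<^sub>m \<phi>}"

definition bfs :: "'i rel_lang \<Rightarrow> ('i, 'a) rel_struct \<Rightarrow> ('a \<rightharpoonup> 'a) set \<Rightarrow> bool" where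
  "bfs L X \<Pi> \<longleftrightarrow> \<Pi> \<subseteq> Pc L X \<and> \<Pi> \<noteq> {} \<and>
     (\<forall>\<phi>\<in>\<Pi>. \<forall>a\<in>univ X. \<exists>\<psi>\<in>\<Pi>. \<phi> \<subseteq>\<^sub>m \<psi> \<and> a \<in> dom \<psi>) \<and>
     (\<forall>\<phi>\<in>\<Pi>. \<forall>b\<in>univ X. \<exists>\<psi>\<in>\<Pi>. \<phi> \<subseteq>\<^sub>m \<psi> \<and> b \<in> ran \<psi>)"

text \<open>The ordinals below a cardinal \<open>\<kappa>\<close> are rendered as well-orders \<open>\<gamma> <o \<kappa>\<close> on the type of \<open>\<kappa>\<close>.
  This loses none of them: up to isomorphism they are the proper initial segments of \<open>\<kappa>\<close>.
  The empty sequence is included.\<close>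

definition closed_order :: "'k rel \<Rightarrow> 'p set \<Rightarrow> ('p \<Rightarrow> 'p \<Rightarrow> bool) \<Rightarrow> bool" where
  "closed_order \<kappa> P le \<longleftrightarrow> (\<forall>(\<gamma> :: 'k rel) (p :: 'k \<Rightarrow> 'p).
     \<gamma> <o \<kappa> \<and> (\<forall>\<alpha>\<in>Field \<gamma>. p \<alpha> \<in> P) \<and>
     (\<forall>\<alpha> \<beta>. (\<alpha>, \<beta>) \<in> \<gamma> \<and> \<alpha> \<noteq> \<beta> \<longrightarrow> le (p \<beta>) (p \<alpha>)) \<longrightarrow>
     (\<exists>q\<in>P. \<forall>\<alpha>\<in>Field \<gamma>. le q (p \<alpha>)))"

definition closed_system :: "'k rel \<Rightarrow> ('a \<rightharpoonup> 'a) set \<Rightarrow> bool" where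
  "closed_system \<kappa> \<Pi> \<longleftrightarrow> closed_order \<kappa> \<Pi> (\<lambda>\<psi> \<phi>. \<phi> \<subseteq>\<^sub>m \<psi>)"

end

(* A condensation that is not an automorphism is a one-element back and forth system, which is
   trivially closed. Conversely, fix an enumeration of the domain in order type kappa; transfinite
   recursion along kappa produces an increasing chain in the system, using closure below each stage
   and back and forth at the stage itself. The union of the chain is a condensation extending the bad
   partial condensation, so it is not an automorphism. For kappa = omega closure is automatic,
   because only finite sequences have to be bounded. *)
theory Submission
  imports Defs
begin

section \<open>Unions of chains of partial condensations\<close>

text \<open>Points are added one at a time, and the larger of two comparable members covers both
  domains. Since arities are finite, each tuple over the union of the domains can thus be handled
  inside a single member of the chain.\<close>

lemma chain_common_member:
  fixes C :: "('a \<rightharpoonup> 'b) set"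
  assumes chain: "\<And>\<phi> \<psi>. \<phi> \<in> C \<Longrightarrow> \<psi> \<in> C \<Longrightarrow> \<phi> \<subseteq>\<^sub>m \<psi> \<or> \<psi> \<subseteq>\<^sub>m \<phi>"
    and "C \<noteq> {}" and "finite A" and "A \<subseteq> (\<Union>\<phi>\<in>C. dom \<phi>)"
  shows "\<exists>\<phi>\<in>C. A \<subseteq> dom \<phi>"
  using \<open>finite A\<close> \<open>A \<subseteq> _\<close>
proof (induction A rule: finite_induct)
  case empty
  then show ?case using \<open>C \<noteq> {}\<close> by blast
next
  case (insert a A)
  then obtain \<phi> \<psi> where "\<phi> \<in> C" "A \<subseteq> dom \<phi>" "\<psi> \<in> C" "a \<in> dom \<psi>" by auto
  then show ?case
    using chain[of \<phi> \<psi>] map_le_implies_dom_le[of \<phi> \<psi>] map_le_implies_dom_le[of \<psi> \<phi>] by blast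
qed

lemma app_tuple_eq_map:
  assumes "\<And>a. a \<in> dom \<phi> \<Longrightarrow> \<phi> a = Some (g a)" and "xs \<in> tuples (dom \<phi>) n"
  shows "app_tuple \<phi> xs = map g xs"
proof -
  have "set xs \<subseteq> dom \<phi>" using assms(2) by (simp add: tuples_def)
  then have "the (\<phi> x) = g x" if "x \<in> set xs" for x
    using assms(1)[of x] subsetD[OF _ that] by simp
  then show ?thesis by (simp add: app_tuple_def)
qed

text \<open>Injectivity and preservation of the relations concern only finitely many points at a
  time, so they are inherited from one member of \<open>C\<close>; surjectivity comes from the
  ranges. The agreement of \<open>g\<close> with each member is part of the conclusion so that
  badness of a member can be carried over to \<open>g\<close>.\<close>

lemma condensation_of_chain:
  fixes L :: "'i rel_lang" and X :: "('i, 'a) rel_struct"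
  assumes C: "C \<subseteq> Pc L X" "C \<noteq> {}"
    and chain: "\<And>\<phi> \<psi>. \<phi> \<in> C \<Longrightarrow> \<psi> \<in> C \<Longrightarrow> \<phi> \<subseteq>\<^sub>m \<psi> \<or> \<psi> \<subseteq>\<^sub>m \<phi>"
    and doms: "univ X \<subseteq> (\<Union>\<phi>\<in>C. dom \<phi>)" and rans: "univ X \<subseteq> (\<Union>\<phi>\<in>C. ran \<phi>)"
  shows "\<exists>g. condensation L X g \<and> (\<forall>\<phi>\<in>C. \<forall>a\<in>dom \<phi>. \<phi> a = Some (g a))"
proof -
  \<comment> \<open>Any member defined at \<open>a\<close> may be chosen: comparable maps agree
    where both are defined. Outside \<open>univ X\<close> the value is arbitrary.\<close>
  define g where "g a = the ((SOME \<phi>. \<phi> \<in> C \<and> a \<in> dom \<phi>) a)" for a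
  have g: "\<phi> a = Some (g a)" if "\<phi> \<in> C" "a \<in> dom \<phi>" for \<phi> a
  proof -
    define \<psi> where "\<psi> = (SOME \<phi>. \<phi> \<in> C \<and> a \<in> dom \<phi>)"
    have \<psi>: "\<psi> \<in> C \<and> a \<in> dom \<psi>" unfolding \<psi>_def by (rule someI[of _ \<phi>]) (use that in blast)
    then have "\<psi> a = Some (g a)" by (auto simp: g_def \<psi>_def[symmetric])
    moreover have "\<phi> a = \<psi> a" using chain[of \<phi> \<psi>] \<psi> that unfolding map_le_def by metis
    ultimately show ?thesis by simp
  qed
  have common: "\<exists>\<phi>\<in>C. A \<subseteq> dom \<phi>" if "finite A" "A \<subseteq> univ X" for A
    by (rule chain_common_member) (use chain C doms that in blast)+
  have into: "g a \<in> univ X" if "a \<in> univ X" for a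
  proof -
    obtain \<phi> where "\<phi> \<in> C" "a \<in> dom \<phi>" using doms \<open>a \<in> univ X\<close> by blast
    with g C(1) show ?thesis by (fastforce simp: Pc_def intro: ranI)
  qed
  have "inj_on g (univ X)"
  proof (rule inj_onI)
    fix a b assume ab: "a \<in> univ X" "b \<in> univ X" "g a = g b"
    obtain \<phi> where "\<phi> \<in> C" "{a, b} \<subseteq> dom \<phi>" using common[of "{a, b}"] ab by auto
    moreover have "inj_on \<phi> (dom \<phi>)" using \<open>\<phi> \<in> C\<close> C(1) by (auto simp: Pc_def)
    ultimately show "a = b" using g[of \<phi> a] g[of \<phi> b] ab(3) by (simp add: inj_on_def)
  qed
  moreover have "univ X \<subseteq> g ` univ X"
  proof
    fix b assume "b \<in> univ X"
    then obtain \<phi> a where \<phi>: "\<phi> \<in> C" "\<phi> a = Some b" using rans by (auto simp: ran_def)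
    then have "a \<in> univ X" using C(1) domI[of \<phi> a b] unfolding Pc_def by blast
    moreover have "g a = b" using g[of \<phi> a] \<phi> by auto
    ultimately show "b \<in> g ` univ X" by blast
  qed
  ultimately have bij: "bij_betw g (univ X) (univ X)" using into by (auto simp: bij_betw_def)
  have "map g xs \<in> rel X i"
    if i: "i \<in> idx L" and xs: "xs \<in> tuples (univ X) (ar L i)" "xs \<in> rel X i" for i xs
  proof -
    obtain \<phi> where \<phi>: "\<phi> \<in> C" "set xs \<subseteq> dom \<phi>"
      using common[of "set xs"] xs(1) by (auto simp: tuples_def)
    then have xs': "xs \<in> tuples (dom \<phi>) (ar L i)" using xs(1) by (auto simp: tuples_def)
    with \<phi> C(1) i xs(2) have "app_tuple \<phi> xs \<in> rel X i" by (auto simp: Pc_def)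
    moreover have "app_tuple \<phi> xs = map g xs"
      by (rule app_tuple_eq_map[OF g[OF \<phi>(1)] xs'])
    ultimately show ?thesis by simp
  qed
  with bij g show ?thesis unfolding condensation_def by blast
qed

section \<open>From a closed system above a bad map to a condensation\<close>

lemma bfs_forth:
  assumes "bfs L X \<Pi>" and "\<phi> \<in> \<Pi>" and "a \<in> univ X"
  shows "\<exists>\<psi>\<in>\<Pi>. \<phi> \<subseteq>\<^sub>m \<psi> \<and> a \<in> dom \<psi>"
  using assms by (simp add: bfs_def)

lemma bfs_back:
  assumes "bfs L X \<Pi>" and "\<phi> \<in> \<Pi>" and "b \<in> univ X"
  shows "\<exists>\<psi>\<in>\<Pi>. \<phi> \<subseteq>\<^sub>m \<psi> \<and> b \<in> ran \<psi>"
  using assms by (simp add: bfs_def)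

lemma closed_systemD:
  fixes \<kappa> \<gamma> :: "'k rel"
  assumes "closed_system \<kappa> \<Pi>" and "\<gamma> <o \<kappa>" and "\<And>\<alpha>. \<alpha> \<in> Field \<gamma> \<Longrightarrow> p \<alpha> \<in> \<Pi>"
    and "\<And>\<alpha> \<beta>. (\<alpha>, \<beta>) \<in> \<gamma> \<Longrightarrow> \<alpha> \<noteq> \<beta> \<Longrightarrow> p \<alpha> \<subseteq>\<^sub>m p \<beta>"
  shows "\<exists>q\<in>\<Pi>. \<forall>\<alpha>\<in>Field \<gamma>. p \<alpha> \<subseteq>\<^sub>m q"
  using assms(1)[unfolded closed_system_def closed_order_def, rule_format, of \<gamma> p] assms(2-4)
  by simp

text \<open>Each point of the domain is treated at its own stage below \<open>\<kappa>\<close>; the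
  earlier stages form a sequence of order type less than \<open>\<kappa>\<close>, which closure
  bounds. Badness survives extension, because the tuple witnessing it keeps its image.\<close>

lemma not_reversible_if_closed_bfs:
  fixes L :: "'i rel_lang" and X :: "('i, 'a) rel_struct" and \<kappa> :: "'k rel"
  assumes card: "Card_order \<kappa>" "|univ X| =o \<kappa>" and inf: "natLeq \<le>o \<kappa>"
    and bad: "\<phi>s \<in> Bad L X" and above: "\<Pi> \<subseteq> Pc_above L X \<phi>s"
    and bfs: "bfs L X \<Pi>" and closed: "closed_system \<kappa> \<Pi>"
  shows "\<not> reversible L X"
proof -
  have wo: "Well_order \<kappa>" using card(1) by (auto simp: card_order_on_def)
  then have wor: "wo_rel \<kappa>" by (simp add: wo_rel_def)
  have "|Field \<kappa>| =o |univ X|"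
    using ordIso_transitive[OF card_of_Field_ordIso[OF card(1)] ordIso_symmetric[OF card(2)]] .
  then obtain e where e: "bij_betw e (Field \<kappa>) (univ X)"
    unfolding card_of_ordIso[symmetric] by blast
  \<comment> \<open>A forth step followed by a back step: the second only enlarges the map, so the
    domain gained first is kept.\<close>
  have extend: "\<exists>\<psi>\<in>\<Pi>. \<phi> \<subseteq>\<^sub>m \<psi> \<and> a \<in> dom \<psi> \<and> a \<in> ran \<psi>"
    if \<phi>: "\<phi> \<in> \<Pi>" and a: "a \<in> univ X" for \<phi> a
  proof -
    obtain \<psi> where \<psi>: "\<psi> \<in> \<Pi>" "\<phi> \<subseteq>\<^sub>m \<psi>" "a \<in> dom \<psi>"
      using bfs_forth[OF bfs \<phi> a] by blast
    obtain \<chi> where \<chi>: "\<chi> \<in> \<Pi>" "\<psi> \<subseteq>\<^sub>m \<chi>" "a \<in> ran \<chi>"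
      using bfs_back[OF bfs \<psi>(1) a] by blast
    have "\<phi> \<subseteq>\<^sub>m \<chi>" "a \<in> dom \<chi>"
      using map_le_trans[OF \<psi>(2) \<chi>(2)] map_le_implies_dom_le[OF \<chi>(2)] \<psi>(3) by auto
    with \<chi> show ?thesis by blast
  qed
  \<comment> \<open>This says that \<open>\<psi>\<close> is an admissible value at stage
    \<open>x\<close> after the earlier values of \<open>f\<close>. The guard makes the condition
    vacuous off \<open>Field \<kappa>\<close>, as the recursion runs over the whole type.\<close>
  define P where "P f x \<psi> \<longleftrightarrow> (x \<in> Field \<kappa> \<longrightarrow>
    \<psi> \<in> \<Pi> \<and> (\<forall>y\<in>underS \<kappa> x. f y \<subseteq>\<^sub>m \<psi>) \<and> e x \<in> dom \<psi> \<and> e x \<in> ran \<psi>)"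
    for f :: "'k \<Rightarrow> 'a \<rightharpoonup> 'a" and x \<psi>
  have "\<exists>f. \<forall>x. P f x (f x)"
  \<comment> \<open>Well-founded recursion with choice asks that \<open>P\<close> look at
    \<open>f\<close> only below \<open>x\<close> and that an admissible value exist whenever all
    earlier values are admissible.\<close>
  proof (rule dependent_wf_choice[of "\<kappa> - Id" P])
    show "wf (\<kappa> - Id)" using wo by (simp add: well_order_on_def)
    show "P f x r = P g x r" if "\<And>z. (z, x) \<in> \<kappa> - Id \<Longrightarrow> f z = g z" for f g x r
      using that unfolding P_def underS_def by auto
    show "\<exists>r. P f x r" if IH: "\<And>y. (y, x) \<in> \<kappa> - Id \<Longrightarrow> P f y (f y)" for x f
    proof (cases "x \<in> Field \<kappa>")
      case True
      \<comment> \<open>The predecessors of \<open>x\<close> form an ordinal below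
        \<open>\<kappa>\<close>, which is the index set to which closure is applied. At the least
        stage it is empty, and closure just supplies some member of \<open>\<Pi>\<close>.\<close>
      let ?\<gamma> = "Restr \<kappa> (underS \<kappa> x)"
      have Field: "Field ?\<gamma> = underS \<kappa> x"
        using Field_Restr_ofilter[OF wo wo_rel.underS_ofilter[OF wor]] .
      have less: "?\<gamma> <o \<kappa>" using wo True by (intro underS_Restr_ordLess) auto
      have sub: "y \<in> Field \<kappa>" "P f y (f y)" if "y \<in> underS \<kappa> x" for y
        using that IH by (auto simp: underS_def Field_def)
      have "f y \<in> \<Pi>" if "y \<in> Field ?\<gamma>" for y
        using sub[of y] Field that unfolding P_def by simp
      moreover have "f y \<subseteq>\<^sub>m f z" if "(y, z) \<in> ?\<gamma>" "y \<noteq> z" for y z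
        using sub[of z] that unfolding P_def by (simp add: underS_def)
      ultimately obtain \<phi> where \<phi>: "\<phi> \<in> \<Pi>" "\<forall>y\<in>underS \<kappa> x. f y \<subseteq>\<^sub>m \<phi>"
        using closed_systemD[OF closed less, of f] unfolding Field by blast
      have "e x \<in> univ X" using bij_betwE[OF e] True by blast
      from extend[OF \<phi>(1) this] obtain \<psi> where
        "\<psi> \<in> \<Pi>" "\<phi> \<subseteq>\<^sub>m \<psi>" "e x \<in> dom \<psi>" "e x \<in> ran \<psi>" by blast
      moreover from this \<phi>(2) have "\<forall>y\<in>underS \<kappa> x. f y \<subseteq>\<^sub>m \<psi>" using map_le_trans by blast
      ultimately show ?thesis unfolding P_def by blast
    qed (simp add: P_def)
  qed
  then obtain f where f: "\<And>x. x \<in> Field \<kappa> \<Longrightarrow>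
      f x \<in> \<Pi> \<and> (\<forall>y\<in>underS \<kappa> x. f y \<subseteq>\<^sub>m f x) \<and> e x \<in> dom (f x) \<and> e x \<in> ran (f x)"
    unfolding P_def by blast
  define C where "C = f ` Field \<kappa>"
  have "C \<subseteq> \<Pi>" using f by (auto simp: C_def)
  \<comment> \<open>An infinite cardinal has nonempty field, so the chain has a member, and with it
    a map that extends \<open>\<phi>s\<close>.\<close>
  have "Field \<kappa> \<noteq> {}"
  proof
    assume "Field \<kappa> = {}"
    moreover have "|Field natLeq| \<le>o |Field \<kappa>|" using inf card_of_mono2 by blast
    ultimately show False using card_of_ordLeq_finite by (fastforce simp: Field_natLeq)
  qed
  then have "C \<noteq> {}" by (simp add: C_def)
  have chain: "\<phi> \<subseteq>\<^sub>m \<psi> \<or> \<psi> \<subseteq>\<^sub>m \<phi>" if \<phi>\<psi>: "\<phi> \<in> C" "\<psi> \<in> C" for \<phi> \<psi>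
  proof -
    obtain x y where xy: "x \<in> Field \<kappa>" "y \<in> Field \<kappa>" "\<phi> = f x" "\<psi> = f y"
      using \<phi>\<psi> by (auto simp: C_def)
    then consider "x = y" | "x \<in> underS \<kappa> y" | "y \<in> underS \<kappa> x"
      using wo_rel.TOTALS[OF wor] by (auto simp: underS_def)
    then show ?thesis using f xy by cases auto
  qed
  have "univ X = e ` Field \<kappa>" using e by (simp add: bij_betw_def)
  then have cover: "univ X \<subseteq> (\<Union>\<phi>\<in>C. dom \<phi>)" "univ X \<subseteq> (\<Union>\<phi>\<in>C. ran \<phi>)"
    using f by (fastforce simp: C_def simp del: domIff)+
  have "C \<subseteq> Pc L X" using \<open>C \<subseteq> \<Pi>\<close> above by (auto simp: Pc_above_def)
  then obtain g where g: "condensation L X g" "\<forall>\<phi>\<in>C. \<forall>a\<in>dom \<phi>. \<phi> a = Some (g a)"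
    using condensation_of_chain[OF _ \<open>C \<noteq> {}\<close> chain cover] by blast
  obtain i xs where ixs: "i \<in> idx L" "xs \<in> tuples (dom \<phi>s) (ar L i)" "xs \<notin> rel X i"
      "app_tuple \<phi>s xs \<in> rel X i"
    using bad by (auto simp: Bad_def)
  \<comment> \<open>Any member of the chain will do, as all of \<open>\<Pi>\<close> lies above
    \<open>\<phi>s\<close>; through it \<open>g\<close> agrees with \<open>\<phi>s\<close> on
    \<open>xs\<close>.\<close>
  obtain \<phi> where \<phi>: "\<phi> \<in> C" "\<phi>s \<subseteq>\<^sub>m \<phi>"
    using \<open>C \<noteq> {}\<close> \<open>C \<subseteq> \<Pi>\<close> above by (auto simp: Pc_above_def)
  have "\<phi>s a = Some (g a)" if "a \<in> dom \<phi>s" for a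
    using g(2) \<phi> that map_le_implies_dom_le[OF \<phi>(2)] by (force simp: map_le_def)
  then have "app_tuple \<phi>s xs = map g xs"
    by (rule app_tuple_eq_map[OF _ ixs(2)])
  moreover have "xs \<in> tuples (univ X) (ar L i)"
    using ixs(2) bad by (auto simp: tuples_def Bad_def Pc_def)
  ultimately have "\<not> automorphism L X g" using ixs by (auto simp: automorphism_def)
  with g(1) show ?thesis by (auto simp: reversible_def)
qed

section \<open>From a condensation to a system\<close>

text \<open>Read as a partial map, a condensation has all of \<open>univ X\<close> as domain and as
  range, so it answers every back and forth demand itself.\<close>

lemma not_reversible_imp_singleton_bfs:
  fixes L :: "'i rel_lang" and X :: "('i, 'a) rel_struct"
  assumes "\<not> reversible L X"
  shows "\<exists>\<phi>\<in>Bad L X. bfs L X {\<phi>}"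
proof -
  obtain f where cond: "condensation L X f" and naut: "\<not> automorphism L X f"
    using assms by (auto simp: reversible_def)
  \<comment> \<open>The total function \<open>f\<close> is unconstrained outside the structure, so
    it is cut down to \<open>univ X\<close>.\<close>
  define \<phi> where "\<phi> = (\<lambda>x. if x \<in> univ X then Some (f x) else None)"
  have dom: "dom \<phi> = univ X" by (auto simp: \<phi>_def dom_def)
  have bij: "bij_betw f (univ X) (univ X)" using cond by (simp add: condensation_def)
  have "ran \<phi> = f ` univ X" by (auto simp: \<phi>_def ran_def)
  then have ran: "ran \<phi> = univ X" using bij by (simp add: bij_betw_def)
  have inj: "inj_on \<phi> (univ X)" using bij by (auto simp: \<phi>_def bij_betw_def inj_on_def)
  have app: "app_tuple \<phi> xs = map f xs" if "xs \<in> tuples (univ X) n" for xs n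
    by (rule app_tuple_eq_map) (use that dom in \<open>auto simp: \<phi>_def\<close>)
  have Pc: "\<phi> \<in> Pc L X" using cond dom ran inj app by (auto simp: Pc_def condensation_def)
  obtain i xs where "i \<in> idx L" "xs \<in> tuples (univ X) (ar L i)" "xs \<notin> rel X i" "map f xs \<in> rel X i"
    using cond naut by (auto simp: condensation_def automorphism_def)
  then have "\<phi> \<in> Bad L X" using Pc dom app by (auto simp: Bad_def)
  moreover have "bfs L X {\<phi>}" using Pc dom ran by (simp add: bfs_def)
  ultimately show ?thesis by blast
qed

lemma closed_system_singleton: "closed_system \<kappa> {\<phi>}"
  unfolding closed_system_def closed_order_def by auto

section \<open>The countable case\<close>

text \<open>Whatever extends a map above \<open>\<phi>\<close> is again above \<open>\<phi>\<close>,
  so the old witnesses remain available. This turns a system that merely contains a bad map into one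
  lying entirely above it.\<close>

lemma bfs_restrict_above:
  assumes "bfs L X \<Pi>" and "\<phi> \<in> \<Pi>"
  shows "bfs L X {\<psi> \<in> \<Pi>. \<phi> \<subseteq>\<^sub>m \<psi>}"
proof -
  let ?\<Pi> = "{\<psi> \<in> \<Pi>. \<phi> \<subseteq>\<^sub>m \<psi>}"
  have up: "\<chi> \<in> ?\<Pi>" if "\<psi> \<in> ?\<Pi>" "\<chi> \<in> \<Pi>" "\<psi> \<subseteq>\<^sub>m \<chi>" for \<psi> \<chi>
    using that map_le_trans by blast
  have "\<exists>\<chi>\<in>?\<Pi>. \<psi> \<subseteq>\<^sub>m \<chi> \<and> a \<in> dom \<chi>" if "\<psi> \<in> ?\<Pi>" "a \<in> univ X" for \<psi> a
    using assms(1) that up[OF that(1)] unfolding bfs_def by fast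
  moreover have "\<exists>\<chi>\<in>?\<Pi>. \<psi> \<subseteq>\<^sub>m \<chi> \<and> b \<in> ran \<chi>" if "\<psi> \<in> ?\<Pi>" "b \<in> univ X" for \<psi> b
    using assms(1) that up[OF that(1)] unfolding bfs_def by fast
  moreover have "\<phi> \<in> ?\<Pi>" "?\<Pi> \<subseteq> Pc L X" using assms by (auto simp: bfs_def)
  ultimately show ?thesis unfolding bfs_def by blast
qed

text \<open>A well-order below \<omega> has a finite field, so the value at its greatest index
  bounds the sequence. For the empty sequence any member of \<open>\<Pi>\<close> is a bound.\<close>

lemma closed_system_omega:
  fixes \<kappa> :: "'k rel"
  assumes "\<kappa> =o natLeq" and "\<Pi> \<noteq> {}"
  shows "closed_system \<kappa> \<Pi>"
  unfolding closed_system_def closed_order_def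
proof (intro allI impI, elim conjE)
  fix \<gamma> :: "'k rel" and p :: "'k \<Rightarrow> 'a \<rightharpoonup> 'a"
  assume less: "\<gamma> <o \<kappa>" and p: "\<forall>\<alpha>\<in>Field \<gamma>. p \<alpha> \<in> \<Pi>"
    and mono: "\<forall>\<alpha> \<beta>. (\<alpha>, \<beta>) \<in> \<gamma> \<and> \<alpha> \<noteq> \<beta> \<longrightarrow> p \<alpha> \<subseteq>\<^sub>m p \<beta>"
  have wo: "Well_order \<gamma>" using less by (auto simp: ordLess_def)
  have "|Field \<gamma>| \<le>o \<gamma>" using card_of_least[OF wo] .
  also have "\<gamma> <o natLeq" using ordLess_ordIso_trans[OF less assms(1)] .
  finally have "|Field \<gamma>| <o natLeq" .
  then have fin: "finite (Field \<gamma>)" by (simp add: finite_iff_ordLess_natLeq)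
  show "\<exists>q\<in>\<Pi>. \<forall>\<alpha>\<in>Field \<gamma>. p \<alpha> \<subseteq>\<^sub>m q"
  proof (cases "Field \<gamma> = {}")
    case True
    then show ?thesis using \<open>\<Pi> \<noteq> {}\<close> by blast
  next
    case False
    \<comment> \<open>Stated for all finite nonempty subsets of the field so that induction applies;
      the field itself is the case needed.\<close>
    have "\<exists>m\<in>A. \<forall>\<alpha>\<in>A. (\<alpha>, m) \<in> \<gamma>" if "finite A" "A \<noteq> {}" "A \<subseteq> Field \<gamma>" for A
      using that
    proof (induction A rule: finite_ne_induct)
      case (singleton x)
      then show ?case
        using wo by (auto simp: well_order_on_def linear_order_on_def partial_order_on_def
            preorder_on_def refl_on_def)
    next
      case (insert x F)
      then obtain m where m: "m \<in> F" "\<forall>\<alpha>\<in>F. (\<alpha>, m) \<in> \<gamma>" by blast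
      interpret wo_rel \<gamma> using wo by (simp add: wo_rel_def)
      have "(x, m) \<in> \<gamma> \<or> (m, x) \<in> \<gamma>" "(x, x) \<in> \<gamma>"
        using TOTALS insert.prems m(1) by blast+
      then show ?case using m TRANS by (auto dest: transD)
    qed
    from this[OF fin False] obtain m where "m \<in> Field \<gamma>" "\<forall>\<alpha>\<in>Field \<gamma>. (\<alpha>, m) \<in> \<gamma>" by blast
    \<comment> \<open>Monotonicity speaks of distinct indices only; at \<open>m\<close> itself
      reflexivity of map inclusion takes over.\<close>
    then show ?thesis using p mono by (metis map_le_refl)
  qed
qed

theorem theorem3p1:
  fixes L :: "'i rel_lang" and X :: "('i, 'a) rel_struct" and \<kappa> :: "'k rel"
  assumes "relational_language L"
    and "structure_for L X"
    and "Card_order \<kappa>" and "|univ X| =o \<kappa>" and "natLeq \<le>o \<kappa>"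
  shows "(\<not> reversible L X \<longleftrightarrow>
            (\<exists>\<phi>s\<in>Bad L X. \<exists>\<Pi>. \<Pi> \<subseteq> Pc_above L X \<phi>s \<and> bfs L X \<Pi> \<and> closed_system \<kappa> \<Pi>))
       \<and> (\<kappa> =o natLeq \<longrightarrow>
            (\<not> reversible L X \<longleftrightarrow> (\<exists>\<Pi>. bfs L X \<Pi> \<and> \<Pi> \<inter> Bad L X \<noteq> {})))"
proof (intro conjI impI iffI)
  assume "\<not> reversible L X"
  then obtain \<phi> where "\<phi> \<in> Bad L X" "bfs L X {\<phi>}"
    using not_reversible_imp_singleton_bfs by blast
  moreover from this have "{\<phi>} \<subseteq> Pc_above L X \<phi>" by (simp add: Bad_def Pc_above_def)
  ultimately show "\<exists>\<phi>s\<in>Bad L X. \<exists>\<Pi>. \<Pi> \<subseteq> Pc_above L X \<phi>s \<and> bfs L X \<Pi> \<and> closed_system \<kappa> \<Pi>"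
    using closed_system_singleton by blast
next
  assume "\<exists>\<phi>s\<in>Bad L X. \<exists>\<Pi>. \<Pi> \<subseteq> Pc_above L X \<phi>s \<and> bfs L X \<Pi> \<and> closed_system \<kappa> \<Pi>"
  then obtain \<phi>s \<Pi> where "\<phi>s \<in> Bad L X" "\<Pi> \<subseteq> Pc_above L X \<phi>s" "bfs L X \<Pi>" "closed_system \<kappa> \<Pi>"
    by blast
  then show "\<not> reversible L X" by (rule not_reversible_if_closed_bfs[OF assms(3-5)])
next
  assume "\<not> reversible L X"
  then obtain \<phi> where "\<phi> \<in> Bad L X" "bfs L X {\<phi>}"
    using not_reversible_imp_singleton_bfs by blast
  then show "\<exists>\<Pi>. bfs L X \<Pi> \<and> \<Pi> \<inter> Bad L X \<noteq> {}" by (intro exI[of _ "{\<phi>}"]) simp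
next
  assume omega: "\<kappa> =o natLeq" and "\<exists>\<Pi>. bfs L X \<Pi> \<and> \<Pi> \<inter> Bad L X \<noteq> {}"
  then obtain \<Pi> \<phi> where \<phi>: "bfs L X \<Pi>" "\<phi> \<in> \<Pi>" "\<phi> \<in> Bad L X" by blast
  \<comment> \<open>The bad map found in \<open>\<Pi>\<close> serves as the base map
    \<open>\<phi>s\<close>, which reduces (c) to (b).\<close>
  let ?\<Pi> = "{\<psi> \<in> \<Pi>. \<phi> \<subseteq>\<^sub>m \<psi>}"
  have "bfs L X ?\<Pi>" using \<phi> bfs_restrict_above by blast
  moreover have "?\<Pi> \<subseteq> Pc_above L X \<phi>" using \<phi>(1) by (auto simp: bfs_def Pc_above_def)
  moreover have "closed_system \<kappa> ?\<Pi>" using omega \<phi>(2) by (intro closed_system_omega) auto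
  ultimately show "\<not> reversible L X"
    by (intro not_reversible_if_closed_bfs[OF assms(3-5) \<phi>(3)])
qed

end
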